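(* Suppose $\left|\frac{r-\gamma_n}{1+\gamma_n}\right|<1$, and suppose either both $r,\gamma_n>-1$ or both $r,\gamma_n<-1$. Let $c^\infty$ be the cutoff at which the (unique) steady-state strategy switches between continuing and stopping, and let $c^\bullet$ be the cutoff at which the objectively optimal strategy (the optimal strategy under the true law $\Psi(\mu_1^\bullet,\mu_2^\bullet;r)$) switches between continuing and stopping. If $r-\gamma_n<0$, then $c^\infty<c^\bullet$. If $r-\gamma_n>0$, then $c^\infty>c^\bullet$.
   Context: Fix $\sigma>0$, $q\in[0,1)$, $\kappa\in\mathbb R$, true means $\mu_1^\bullet,\mu_2^\bullet\in\mathbb R$, a true reversal parameter $r\in\mathbb R$ and an interval $[\gamma_l,\gamma_h]$, with $r,\gamma_l,\gamma_h\ne-1$. Let $\gamma_n:=\arg\min_{\gamma\in[\gamma_l,\gamma_h]}|\gamma-r|$. Stage game: the agent observes $X_1=x_1$ and either stops, receiving $u_1(x_1)=x_1$, or continues, in which case $X_2=x_2$ is drawn and she receives $u_2(x_1,x_2)=q\max(x_1,x_2)+(1-q)x_2-\kappa$. A strategy is a measurable map $S:\mathbb R\to\{\text{Stop},\text{Continue}\}$; strategies that differ only on a Lebesgue-null set are identified. $S$ continues with positive probability if $S^{-1}(\text{Continue})$ has positive Lebesgue measure. $\Psi(\mu_1,\mu_2;\gamma)$ is the joint law with $X_1\sim\mathcal N(\mu_1,\sigma^2)$, $X_2\mid(X_1=x_1)\sim\mathcal N(\mu_2-\gamma(x_1-\mu_1),\sigma^2)$; the true law is $\Psi(\mu_1^\bullet,\mu_2^\bullet;r)$.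 For $\gamma\ne-1$ the optimal strategy under $\Psi(\mu_1,\mu_2;\gamma)$ is of cutoff form: there is a unique $C(\mu_1,\mu_2;\gamma)$ at which $u_1(x_1)=\mathbb E_{\Psi(\mu_1,\mu_2;\gamma)}[u_2(x_1,X_2)\mid X_1=x_1]$, and it is optimal to stop iff $x_1\ge C(\mu_1,\mu_2;\gamma)$ when $\gamma>-1$, and iff $x_1\le C(\mu_1,\mu_2;\gamma)$ when $\gamma<-1$. Thus $c^\bullet=C(\mu_1^\bullet,\mu_2^\bullet;r)$. The history is $(x_1,\varnothing)$ if $S(x_1)=\text{Stop}$ and $(x_1,x_2)$ if $S(x_1)=\text{Continue}$; $\mathcal H(\Psi;S)$ is the law of the history when $(X_1,X_2)\sim\Psi$, and $\mathcal H^\bullet(S):=\mathcal H(\Psi(\mu_1^\bullet,\mu_2^\bullet;r);S)$. For $S$ continuing with positive probability, the pseudo-true parameters $(\mu_1^*(S),\mu_2^*(S),\gamma^*(S))$ are the minimizer of the Kullback–Leibler divergence $D_{KL}(\mathcal H^\bullet(S)\,\|\,\mathcal H(\Psi(\mu_1,\mu_2;\gamma);S))$ over $\mathbb R^2\times[\gamma_l,\gamma_h]$. A steady state consists of $\mu_1^\infty,\mu_2^\infty\in\mathbb R$, $\gamma^\infty\in[\gamma_l,\gamma_h]$ and a strategy $S^\infty$ such that (i) $S^\infty$ continues with positive probability and maximizes expected payoff among all strategies when $(X_1,X_2)\sim\Psi(\mu_1^\infty,\mu_2^\infty;\gamma^\infty)$; (ii) $(\mu_1^\infty,\mu_2^\infty,\gamma^\infty)=(\mu_1^*(S^\infty),\mu_2^*(S^\infty),\gamma^*(S^\infty))$.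 Under $|\frac{r-\gamma_n}{1+\gamma_n}|<1$ a unique steady state exists, with $\gamma^\infty=\gamma_n$, and $c^\infty=C(\mu_1^\infty,\mu_2^\infty;\gamma_n)$. *)

theory Defs
  imports "HOL-Probability.Probability"
begin

datatype choice = Stop | Continue

type_synonym strategy = "real \<Rightarrow> choice"

definition is_strategy :: "strategy \<Rightarrow> bool" where
  "is_strategy S \<longleftrightarrow> S \<in> borel \<rightarrow>\<^sub>M count_space UNIV"

definition u1 :: "real \<Rightarrow> real" where
  "u1 x1 = x1"

definition u2 :: "real \<Rightarrow> real \<Rightarrow> real \<Rightarrow> real \<Rightarrow> real" where
  "u2 q \<kappa> x1 x2 = q * max x1 x2 + (1 - q) * x2 - \<kappa>"

text \<open>Joint law of \<open>X1 \<sim> N(\<mu>1, \<sigma>\<^sup>2)\<close> and \<open>X2 | (X1 = x1) \<sim> N(\<mu>2 - \<gamma> (x1 - \<mu>1), \<sigma>\<^sup>2)\<close>, given by its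
  density; the second parameter of \<^const>\<open>normal_density\<close> is the standard deviation.\<close>

definition \<Psi> :: "real \<Rightarrow> real \<Rightarrow> real \<Rightarrow> real \<Rightarrow> (real \<times> real) measure" where
  "\<Psi> \<sigma> \<mu>1 \<mu>2 \<gamma> = density (lborel \<Otimes>\<^sub>M lborel)
     (\<lambda>(x1, x2). ennreal (normal_density \<mu>1 \<sigma> x1 * normal_density (\<mu>2 - \<gamma> * (x1 - \<mu>1)) \<sigma> x2))"

definition payoff :: "real \<Rightarrow> real \<Rightarrow> strategy \<Rightarrow> real \<times> real \<Rightarrow> real" where
  "payoff q \<kappa> S = (\<lambda>(x1, x2). case S x1 of Stop \<Rightarrow> u1 x1 | Continue \<Rightarrow> u2 q \<kappa> x1 x2)"

definition optimal_strategy :: "real \<Rightarrow> real \<Rightarrow> (real \<times> real) measure \<Rightarrow> strategy \<Rightarrow> bool" where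
  "optimal_strategy q \<kappa> M S \<longleftrightarrow> is_strategy S \<and>
     (\<forall>T. is_strategy T \<longrightarrow> integral\<^sup>L M (payoff q \<kappa> T) \<le> integral\<^sup>L M (payoff q \<kappa> S))"

definition continues_with_positive_probability :: "strategy \<Rightarrow> bool" where
  "continues_with_positive_probability S \<longleftrightarrow> emeasure lborel {x. S x = Continue} > 0"

text \<open>Strategies are only determined up to Lebesgue-null sets, so switching at \<open>c\<close> is an almost
  everywhere property (and the action taken at \<open>c\<close> itself is immaterial). Either side of the
  cutoff may be the stopping region.\<close>

definition switches_at :: "strategy \<Rightarrow> real \<Rightarrow> bool" where
  "switches_at S c \<longleftrightarrow>
     (AE x in lborel. S x = Stop \<longleftrightarrow> x \<ge> c) \<or> (AE x in lborel. S x = Stop \<longleftrightarrow> x \<le> c)"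

definition switching_cutoff :: "strategy \<Rightarrow> real" where
  "switching_cutoff S = (THE c. switches_at S c)"

text \<open>A history is \<open>(x1, None)\<close> if the second draw is censored and \<open>(x1, Some x2)\<close> otherwise. The
  optional second draw carries the disjoint-union sigma-algebra of a point and the Borel line.\<close>

definition option_borel :: "real option measure" where
  "option_borel = sigma UNIV (insert {None} ((`) Some ` sets borel))"

definition history :: "strategy \<Rightarrow> real \<times> real \<Rightarrow> real \<times> real option" where
  "history S = (\<lambda>(x1, x2). (x1, case S x1 of Stop \<Rightarrow> None | Continue \<Rightarrow> Some x2))"

definition history_law ::
    "(real \<times> real) measure \<Rightarrow> strategy \<Rightarrow> (real \<times> real option) measure" where
  "history_law M S = distr M (borel \<Otimes>\<^sub>M option_borel) (history S)"

text \<open>The law against which the expectation is taken is the \<^emph>\<open>second\<close> measure argument of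
  \<^const>\<open>KL_divergence\<close>, so \<open>KL_divergence (exp 1) Q P\<close> is \<open>D_KL(P || Q)\<close>.
  It is real-valued, which is harmless here: the history laws under one strategy are mutually
  absolutely continuous with integrable log-likelihood ratios.\<close>

definition pseudo_true ::
    "real \<Rightarrow> real \<Rightarrow> real \<Rightarrow> real \<Rightarrow> real \<Rightarrow> real \<Rightarrow> strategy \<Rightarrow> real \<times> real \<times> real \<Rightarrow> bool" where
  "pseudo_true \<sigma> \<mu>1_true \<mu>2_true r \<gamma>l \<gamma>h S =
     is_arg_min
       (\<lambda>(\<mu>1, \<mu>2, \<gamma>).
          KL_divergence (exp 1) (history_law (\<Psi> \<sigma> \<mu>1 \<mu>2 \<gamma>) S) (history_law (\<Psi> \<sigma> \<mu>1_true \<mu>2_true r) S))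
       (\<lambda>(\<mu>1, \<mu>2, \<gamma>). \<gamma> \<in> {\<gamma>l..\<gamma>h})"

definition steady_state ::
    "real \<Rightarrow> real \<Rightarrow> real \<Rightarrow> real \<Rightarrow> real \<Rightarrow> real \<Rightarrow> real \<Rightarrow> real \<Rightarrow>
     real \<Rightarrow> real \<Rightarrow> real \<Rightarrow> strategy \<Rightarrow> bool" where
  "steady_state \<sigma> q \<kappa> \<mu>1_true \<mu>2_true r \<gamma>l \<gamma>h \<mu>1 \<mu>2 \<gamma> S \<longleftrightarrow>
     continues_with_positive_probability S \<and>
     optimal_strategy q \<kappa> (\<Psi> \<sigma> \<mu>1 \<mu>2 \<gamma>) S \<and>
     pseudo_true \<sigma> \<mu>1_true \<mu>2_true r \<gamma>l \<gamma>h S (\<mu>1, \<mu>2, \<gamma>)"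

end

theory Submission imports Defs begin

text \<open>
  Given \<open>X1 = x\<close>, the gain from continuing is a strictly increasing function of the mean
  \<open>\<mu>2 - \<gamma> (x - \<mu>1) - x\<close> of \<open>X2 - x\<close>, so an optimal strategy continues (almost everywhere) iff
  \<open>(1 + \<gamma>) x < \<mu>2 + \<gamma> \<mu>1 - y\<close>, where the constant \<open>y\<close> depends only on \<open>\<sigma>\<close>, \<open>q\<close>, \<open>\<kappa>\<close>. The
  Kullback-Leibler divergence of the censored histories is \<open>1 / (2 \<sigma>\<^sup>2)\<close> times the squared error
  of \<open>\<mu>1\<close> plus the squared error of the conditional mean of \<open>X2\<close> integrated over the continuation
  region. When \<open>\<mu>1\<close>, \<open>\<mu>2\<close> are the true means, the minimizer satisfies \<open>\<mu>1\<^sup>* = \<mu>1\<close>, \<open>\<gamma>\<^sup>* = \<gamma>n\<close> and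
  \<open>\<mu>2\<^sup>* + \<gamma>n \<mu>1 = \<mu>2 + r \<mu>1 + (\<gamma>n - r) E\<close>, where \<open>E\<close> is the mean of \<open>X1\<close> conditional on
  continuing. Comparing the two cutoff equations yields
  \<open>(1 + r) (c\<^sub>\<infinity> - c\<^sub>o) = (r - \<gamma>n) (c\<^sub>\<infinity> - E)\<close> for the steady-state cutoff \<open>c\<^sub>\<infinity>\<close> and
  the objectively optimal cutoff \<open>c\<^sub>o\<close>, and \<open>(1 + \<gamma>n) (c\<^sub>\<infinity> - E) > 0\<close> because \<open>E\<close> lies inside the
  continuation region.
\<close>

subsection \<open>Gaussian integrals\<close>

text \<open>Expanding the quadratic around the mean reduces it to the moments of order 0 and 1 and
  the second central moment \<sigma>^2.\<close>

lemma normal_quadratic: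
  fixes \<sigma> :: real
  assumes "\<sigma> > 0"
  shows "has_bochner_integral lborel (\<lambda>x. normal_density \<mu> \<sigma> x * (a + b * x + c * x\<^sup>2))
           (a + b * \<mu> + c * (\<mu>\<^sup>2 + \<sigma>\<^sup>2))"
proof -
  have m0: "has_bochner_integral lborel (normal_density \<mu> \<sigma>) 1"
    using assms by (simp add: has_bochner_integral_iff)
  have m1: "has_bochner_integral lborel (\<lambda>x. normal_density \<mu> \<sigma> x * x) \<mu>"
    by (rule normal_moment_nz_1[OF assms])
  have m2: "has_bochner_integral lborel (\<lambda>x. normal_density \<mu> \<sigma> x * (x - \<mu>)\<^sup>2) (\<sigma>\<^sup>2)"
    using normal_moment_even[OF assms, of \<mu> 1] assms by simp
  have "has_bochner_integral lborel
      (\<lambda>x. (normal_density \<mu> \<sigma> x * (a - c * \<mu>\<^sup>2) + normal_density \<mu> \<sigma> x * x * (b + 2 * c * \<mu>))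
            + normal_density \<mu> \<sigma> x * (x - \<mu>)\<^sup>2 * c)
      ((1 * (a - c * \<mu>\<^sup>2) + \<mu> * (b + 2 * c * \<mu>)) + \<sigma>\<^sup>2 * c)"
    by (intro has_bochner_integral_add has_bochner_integral_mult_left m0 m1 m2)
  moreover have "(1 * (a - c * \<mu>\<^sup>2) + \<mu> * (b + 2 * c * \<mu>)) + \<sigma>\<^sup>2 * c
      = a + b * \<mu> + c * (\<mu>\<^sup>2 + \<sigma>\<^sup>2)"
    by (simp add: algebra_simps power2_eq_square)
  moreover have "(\<lambda>x. (normal_density \<mu> \<sigma> x * (a - c * \<mu>\<^sup>2) + normal_density \<mu> \<sigma> x * x * (b + 2 * c * \<mu>))
            + normal_density \<mu> \<sigma> x * (x - \<mu>)\<^sup>2 * c)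
      = (\<lambda>x. normal_density \<mu> \<sigma> x * (a + b * x + c * x\<^sup>2))"
    by (rule ext) (simp add: algebra_simps power2_eq_square)
  ultimately show ?thesis by (simp only:)
qed

lemma integrable_normal_quadratic_bound:
  fixes \<sigma> :: real
  assumes "\<sigma> > 0" and [measurable]: "g \<in> borel_measurable borel"
    and bound: "\<And>x. \<bar>g x\<bar> \<le> K * (a + x\<^sup>2)"
  shows "integrable lborel (\<lambda>x. normal_density \<mu> \<sigma> x * g x)"
proof (rule Bochner_Integration.integrable_bound)
  show "integrable lborel (\<lambda>x. normal_density \<mu> \<sigma> x * (K * a + 0 * x + K * x\<^sup>2))"
    using normal_quadratic[OF assms(1)] by (rule integrable.intros)
  show "AE x in lborel. norm (normal_density \<mu> \<sigma> x * g x)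
      \<le> norm (normal_density \<mu> \<sigma> x * (K * a + 0 * x + K * x\<^sup>2))"
  proof (rule AE_I2)
    fix x :: real
    have "\<bar>g x\<bar> \<le> \<bar>K * a + K * x\<^sup>2\<bar>" using bound[of x] by (simp add: algebra_simps)
    then show "norm (normal_density \<mu> \<sigma> x * g x) \<le> norm (normal_density \<mu> \<sigma> x * (K * a + 0 * x + K * x\<^sup>2))"
      by (simp add: abs_mult mult_left_mono)
  qed
qed simp

text \<open>The mean may vary with the point because the conditional mean of X2 depends on
  x1.\<close>

lemma measurable_normal_density_mean [measurable]:
  assumes [measurable]: "f \<in> borel_measurable M" "g \<in> borel_measurable M"
  shows "(\<lambda>x. normal_density (f x) \<sigma> (g x)) \<in> borel_measurable M"
  unfolding normal_density_def by measurable

lemma abs_le_one_plus_square: "\<bar>t\<bar> \<le> 1 + (t::real)\<^sup>2"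
proof -
  have "0 \<le> (\<bar>t\<bar> - 1)\<^sup>2" by simp
  also have "\<dots> = t\<^sup>2 - 2 * \<bar>t\<bar> + 1" by (simp add: power2_diff)
  finally show ?thesis using zero_le_power2[of t] by linarith
qed

lemma affine_square_bound: "(a - b * x)\<^sup>2 \<le> 2 * a\<^sup>2 + 2 * b\<^sup>2 * (x::real)\<^sup>2"
  using sum_squares_bound[of a "- (b * x)"] by (simp add: power2_eq_square algebra_simps)

text \<open>Fubini for integrands of quadratic growth, a class that contains both the payoffs and
  the log-likelihood ratios; X2 is integrated out first, given X1.\<close>

lemma
  fixes \<sigma> :: real
  assumes s: "\<sigma> > 0" and F[measurable]: "F \<in> borel_measurable (borel \<Otimes>\<^sub>M borel)"
    and bound: "\<And>x y. \<bar>F (x, y)\<bar> \<le> K * (1 + x\<^sup>2 + y\<^sup>2)"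
  shows integral_\<Psi>: "integral\<^sup>L (\<Psi> \<sigma> \<mu>1 \<mu>2 \<gamma>) F =
      (\<integral>x. normal_density \<mu>1 \<sigma> x * (\<integral>y. normal_density (\<mu>2 - \<gamma> * (x - \<mu>1)) \<sigma> y * F (x, y) \<partial>lborel) \<partial>lborel)"
    and integrable_\<Psi>_fst: "integrable lborel
      (\<lambda>x. normal_density \<mu>1 \<sigma> x * (\<integral>y. normal_density (\<mu>2 - \<gamma> * (x - \<mu>1)) \<sigma> y * F (x, y) \<partial>lborel))"
proof -
  define m where "m = (\<lambda>x. \<mu>2 - \<gamma> * (x - \<mu>1))"
  define d where "d = (\<lambda>(x, y). normal_density \<mu>1 \<sigma> x * normal_density (m x) \<sigma> y)"
  have [measurable]: "m \<in> borel_measurable borel" unfolding m_def by measurable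
  have d[measurable]: "d \<in> borel_measurable (lborel \<Otimes>\<^sub>M lborel)"
    unfolding d_def by measurable
  have d0: "d w \<ge> 0" for w by (cases w) (simp add: d_def)
  have Psi: "\<Psi> \<sigma> \<mu>1 \<mu>2 \<gamma> = density (lborel \<Otimes>\<^sub>M lborel) (\<lambda>w. ennreal (d w))"
    unfolding \<Psi>_def by (rule arg_cong[where f = "density _"]) (auto simp: d_def m_def)
  define G where "G = (\<lambda>(x, y). 1 + x\<^sup>2 + y\<^sup>2 :: real)"
  have [measurable]: "G \<in> borel_measurable (borel \<Otimes>\<^sub>M borel)" unfolding G_def by measurable
  have G0: "G w \<ge> 0" for w by (cases w) (simp add: G_def)
  \<comment> \<open>The dominating function \<open>G\<close> has an explicit inner integral, since
    y^2 has conditional mean (m x)^2 + \<sigma>^2; its joint integrability thus reduces to that of a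
    quadratic in x.\<close>
  have slice: "has_bochner_integral lborel (\<lambda>y. d (x, y) * G (x, y))
      (normal_density \<mu>1 \<sigma> x * (1 + x\<^sup>2 + ((m x)\<^sup>2 + \<sigma>\<^sup>2)))" for x
    using has_bochner_integral_mult_right[OF normal_quadratic[OF s, of "m x" "1 + x\<^sup>2" 0 1],
        of "normal_density \<mu>1 \<sigma> x"]
    by (simp add: d_def G_def mult.assoc)
  have dG: "integrable (lborel \<Otimes>\<^sub>M lborel) (\<lambda>w. d w * G w)"
  proof (rule lborel_pair.Fubini_integrable)
    show "AE x in lborel. integrable lborel (\<lambda>y. d (x, y) * G (x, y))"
      using slice by (auto intro: integrable.intros)
    have "(\<integral>y. norm (d (x, y) * G (x, y)) \<partial>lborel)
        = normal_density \<mu>1 \<sigma> x * (1 + x\<^sup>2 + ((m x)\<^sup>2 + \<sigma>\<^sup>2))" for x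
      using has_bochner_integral_integral_eq[OF slice[of x]] by (simp add: d0 G0)
    moreover have "integrable lborel
        (\<lambda>x. normal_density \<mu>1 \<sigma> x * (1 + x\<^sup>2 + ((m x)\<^sup>2 + \<sigma>\<^sup>2)))"
    proof (rule integrable_normal_quadratic_bound[OF s])
      fix x
      have "(m x)\<^sup>2 \<le> 2 * (\<mu>2 + \<gamma> * \<mu>1)\<^sup>2 + 2 * \<gamma>\<^sup>2 * x\<^sup>2"
        using affine_square_bound[of "\<mu>2 + \<gamma> * \<mu>1" \<gamma> x] by (simp add: m_def algebra_simps)
      then show "\<bar>1 + x\<^sup>2 + ((m x)\<^sup>2 + \<sigma>\<^sup>2)\<bar>
          \<le> (1 + 2 * \<gamma>\<^sup>2) * ((1 + 2 * (\<mu>2 + \<gamma> * \<mu>1)\<^sup>2 + \<sigma>\<^sup>2) + x\<^sup>2)"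
        by (simp add: algebra_simps) (smt (verit) zero_le_power2 zero_le_mult_iff)
    qed measurable
    ultimately show "integrable lborel (\<lambda>x. \<integral>y. norm (d (x, y) * G (x, y)) \<partial>lborel)" by simp
  qed measurable
  have dF: "integrable (lborel \<Otimes>\<^sub>M lborel) (\<lambda>w. d w * F w)"
  proof (rule Bochner_Integration.integrable_bound)
    show "integrable (lborel \<Otimes>\<^sub>M lborel) (\<lambda>w. K * (d w * G w))" using dG by simp
    show "AE w in lborel \<Otimes>\<^sub>M lborel. norm (d w * F w) \<le> norm (K * (d w * G w))"
    proof (rule AE_I2)
      fix w :: "real \<times> real"
      obtain x y where w: "w = (x, y)" by (cases w)
      have "\<bar>F w\<bar> \<le> \<bar>K * G w\<bar>" using bound[of x y] by (simp add: w G_def)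
      from mult_left_mono[OF this d0[of w]]
      show "norm (d w * F w) \<le> norm (K * (d w * G w))" using d0[of w] by (simp add: abs_mult ac_simps)
    qed
  qed measurable
  have inner: "(\<integral>y. d (x, y) * F (x, y) \<partial>lborel)
      = normal_density \<mu>1 \<sigma> x * (\<integral>y. normal_density (\<mu>2 - \<gamma> * (x - \<mu>1)) \<sigma> y * F (x, y) \<partial>lborel)" for x
    by (simp add: d_def m_def mult.assoc)
  have "integral\<^sup>L (\<Psi> \<sigma> \<mu>1 \<mu>2 \<gamma>) F = integral\<^sup>L (lborel \<Otimes>\<^sub>M lborel) (\<lambda>w. d w * F w)"
    unfolding Psi using d0 by (subst integral_density) simp_all
  also have "\<dots> = (\<integral>x. \<integral>y. d (x, y) * F (x, y) \<partial>lborel \<partial>lborel)"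
    using lborel_pair.integral_fst'[OF dF] by simp
  finally show "integral\<^sup>L (\<Psi> \<sigma> \<mu>1 \<mu>2 \<gamma>) F =
      (\<integral>x. normal_density \<mu>1 \<sigma> x * (\<integral>y. normal_density (\<mu>2 - \<gamma> * (x - \<mu>1)) \<sigma> y * F (x, y) \<partial>lborel) \<partial>lborel)"
    by (simp add: inner)
  show "integrable lborel
      (\<lambda>x. normal_density \<mu>1 \<sigma> x * (\<integral>y. normal_density (\<mu>2 - \<gamma> * (x - \<mu>1)) \<sigma> y * F (x, y) \<partial>lborel))"
    using lborel_pair.integrable_fst'[OF dF] by (simp add: inner)
qed

subsection \<open>The optimal stopping rule\<close>

text \<open>The gain of continuing over stopping, before the cost \<open>\<kappa>\<close>, when \<open>X2 - x1\<close> has mean \<open>y\<close>: given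
  \<open>x1\<close>, it depends on the model and on \<open>x1\<close> only through \<open>y\<close>.\<close>

definition excess :: "real \<Rightarrow> real \<Rightarrow> real \<Rightarrow> real" where
  "excess \<sigma> q y = (\<integral>z. normal_density 0 \<sigma> z * (q * max 0 (y + z) + (1 - q) * (y + z)) \<partial>lborel)"

lemma excess_integrable:
  fixes \<sigma> q y :: real
  assumes "\<sigma> > 0" "0 \<le> q" "q < 1"
  shows "integrable lborel (\<lambda>z. normal_density 0 \<sigma> z * (q * max 0 (y + z) + (1 - q) * (y + z)))"
proof (rule integrable_normal_quadratic_bound[OF assms(1)])
  fix z :: real
  have "\<bar>q * max 0 (y + z) + (1 - q) * (y + z)\<bar> \<le> q * \<bar>y + z\<bar> + (1 - q) * \<bar>y + z\<bar>"
    using assms by (intro order_trans[OF abs_triangle_ineq] add_mono) (auto simp: abs_mult intro!: mult_left_mono)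
  also have "\<dots> = \<bar>y + z\<bar>" by (simp add: algebra_simps)
  also have "\<dots> \<le> 1 * ((\<bar>y\<bar> + 1) + z\<^sup>2)"
    using abs_le_one_plus_square[of z] abs_triangle_ineq[of y z] by simp
  finally show "\<bar>q * max 0 (y + z) + (1 - q) * (y + z)\<bar> \<le> 1 * ((\<bar>y\<bar> + 1) + z\<^sup>2)" .
qed measurable

text \<open>Moving from y to y' changes the integrand by (1 - q) (y' - y) plus q times an increment
  of \<open>max 0\<close> that lies between 0 and y' - y; averaging over a probability density keeps
  these bounds. As q < 1, the lower one gives strict monotonicity and unboundedness; the upper one
  gives continuity.\<close>

lemma excess_slope:
  fixes \<sigma> q y :: real
  assumes "\<sigma> > 0" "0 \<le> q" "q < 1" "y \<le> y'"
  shows "(1 - q) * (y' - y) \<le> excess \<sigma> q y' - excess \<sigma> q y"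
    and "excess \<sigma> q y' - excess \<sigma> q y \<le> y' - y"
proof -
  let ?f = "\<lambda>y z. normal_density 0 \<sigma> z * (q * max 0 (y + z) + (1 - q) * (y + z))"
  note i = excess_integrable[OF assms(1-3)]
  have n: "integrable lborel (normal_density 0 \<sigma>)" "integral\<^sup>L lborel (normal_density 0 \<sigma>) = 1"
    using assms by simp_all
  have diff: "excess \<sigma> q y' - excess \<sigma> q y = (\<integral>z. ?f y' z - ?f y z \<partial>lborel)"
    unfolding excess_def by (simp add: Bochner_Integration.integral_diff[OF i i])
  have incr: "0 \<le> max 0 (y' + z) - max 0 (y + z)" "max 0 (y' + z) - max 0 (y + z) \<le> y' - y" for z
    using assms(4) by auto
  have fdiff: "?f y' z - ?f y z = normal_density 0 \<sigma> z *
      (q * (max 0 (y' + z) - max 0 (y + z)) + (1 - q) * (y' - y))" for z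
    by (simp add: algebra_simps)
  have ge: "(1 - q) * (y' - y) \<le> q * (max 0 (y' + z) - max 0 (y + z)) + (1 - q) * (y' - y)" for z
    using mult_nonneg_nonneg[OF assms(2) incr(1)[of z]] by simp
  have le: "q * (max 0 (y' + z) - max 0 (y + z)) + (1 - q) * (y' - y) \<le> y' - y" for z
    using mult_left_mono[OF incr(2)[of z] assms(2)] by (simp add: algebra_simps)
  have "(\<integral>z. normal_density 0 \<sigma> z * ((1 - q) * (y' - y)) \<partial>lborel) \<le> (\<integral>z. ?f y' z - ?f y z \<partial>lborel)"
  proof (rule integral_mono)
    show "normal_density 0 \<sigma> z * ((1 - q) * (y' - y)) \<le> ?f y' z - ?f y z" for z
      unfolding fdiff by (intro mult_left_mono ge) simp
  qed (use i n in auto)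
  then show "(1 - q) * (y' - y) \<le> excess \<sigma> q y' - excess \<sigma> q y"
    using n by (simp add: diff)
  have "(\<integral>z. ?f y' z - ?f y z \<partial>lborel) \<le> (\<integral>z. normal_density 0 \<sigma> z * (y' - y) \<partial>lborel)"
  proof (rule integral_mono)
    show "?f y' z - ?f y z \<le> normal_density 0 \<sigma> z * (y' - y)" for z
      unfolding fdiff by (intro mult_left_mono le) simp
  qed (use i n in auto)
  then show "excess \<sigma> q y' - excess \<sigma> q y \<le> y' - y"
    using n by (simp add: diff)
qed

lemma excess_less_iff:
  fixes \<sigma> q y :: real
  assumes "\<sigma> > 0" "0 \<le> q" "q < 1"
  shows "excess \<sigma> q y < excess \<sigma> q y' \<longleftrightarrow> y < y'"
proof -
  have "y < y' \<Longrightarrow> excess \<sigma> q y < excess \<sigma> q y'" for y y'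
    using excess_slope(1)[OF assms, of y y'] mult_pos_pos[of "1 - q" "y' - y"] assms by linarith
  then show ?thesis by (metis linorder_cases order.asym)
qed

text \<open>Intermediate value theorem: a slope of at least 1 - q forces the value k to be reached
  within distance \<open>R\<close> of 0. With k = \<kappa> this gives the mean of X2 - x1 at which
  the agent is indifferent.\<close>

lemma excess_attains:
  fixes \<sigma> q k :: real
  assumes "\<sigma> > 0" "0 \<le> q" "q < 1"
  obtains y where "excess \<sigma> q y = k"
proof -
  define R where "R = \<bar>k - excess \<sigma> q 0\<bar> / (1 - q)"
  have R: "R \<ge> 0" "(1 - q) * R = \<bar>k - excess \<sigma> q 0\<bar>" using assms by (auto simp: R_def)
  have step: "\<bar>excess \<sigma> q y' - excess \<sigma> q y\<bar> \<le> \<bar>y' - y\<bar>" if "y \<le> y'" for y y'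
    using excess_slope[OF assms that] mult_nonneg_nonneg[of "1 - q" "y' - y"] assms that by linarith
  have lip: "\<bar>excess \<sigma> q y' - excess \<sigma> q y\<bar> \<le> \<bar>y' - y\<bar>" for y y'
    using step[of y y'] step[of y' y] by (cases "y \<le> y'") (simp_all add: abs_minus_commute)
  have "continuous_on {-R..R} (excess \<sigma> q)"
    unfolding continuous_on_iff dist_real_def using lip by (meson le_less_trans)
  moreover have "excess \<sigma> q (-R) \<le> k" "k \<le> excess \<sigma> q R"
    using excess_slope(1)[OF assms, of "-R" 0] excess_slope(1)[OF assms, of 0 R] R by auto
  ultimately show thesis
    using IVT'[of "excess \<sigma> q" "-R" k R] R(1) that by auto
qed

section \<open>From the gain of continuing to the optimal strategy\<close>

lemma u2_bound:
  assumes "0 \<le> q" "q < (1::real)"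
  shows "\<bar>u2 q \<kappa> x y\<bar> \<le> (3 + \<bar>\<kappa>\<bar>) * (1 + x\<^sup>2 + y\<^sup>2)"
proof -
  have "\<bar>u2 q \<kappa> x y\<bar> \<le> q * \<bar>max x y\<bar> + (1 - q) * \<bar>y\<bar> + \<bar>\<kappa>\<bar>"
    using assms abs_triangle_ineq[of "q * max x y" "(1 - q) * y"]
      abs_triangle_ineq4[of "q * max x y + (1 - q) * y" \<kappa>]
    by (simp add: u2_def abs_mult)
  also have "\<dots> \<le> 1 * \<bar>max x y\<bar> + 1 * \<bar>y\<bar> + \<bar>\<kappa>\<bar>"
    using assms by (intro add_mono mult_right_mono) auto
  also have "\<dots> \<le> \<bar>x\<bar> + 2 * \<bar>y\<bar> + \<bar>\<kappa>\<bar>" by auto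
  also have "\<dots> \<le> 3 * (1 + x\<^sup>2 + y\<^sup>2) + \<bar>\<kappa>\<bar> * 1"
  proof -
    have "0 \<le> x\<^sup>2" "0 \<le> y\<^sup>2" by simp_all
    then show ?thesis using abs_le_one_plus_square[of x] abs_le_one_plus_square[of y] by argo
  qed
  also have "\<dots> \<le> 3 * (1 + x\<^sup>2 + y\<^sup>2) + \<bar>\<kappa>\<bar> * (1 + x\<^sup>2 + y\<^sup>2)"
    by (intro add_left_mono mult_left_mono) auto
  finally show ?thesis by (simp add: algebra_simps)
qed

text \<open>Substitute y = m + z. Since max x (m + z) = x + max 0 (m - x + z), the value x splits
  off and only m - x remains inside the integral.\<close>

lemma continuation_value:
  fixes \<sigma> :: real
  assumes "\<sigma> > 0" "0 \<le> q" "q < 1"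
  shows "(\<integral>y. normal_density m \<sigma> y * u2 q \<kappa> x y \<partial>lborel) = x + excess \<sigma> q (m - x) - \<kappa>"
proof -
  have "(\<integral>y. normal_density m \<sigma> y * u2 q \<kappa> x y \<partial>lborel)
      = (\<integral>z. normal_density m \<sigma> (m + 1 * z) * u2 q \<kappa> x (m + 1 * z) \<partial>lborel)"
    using lborel_integral_real_affine[of 1 "\<lambda>y. normal_density m \<sigma> y * u2 q \<kappa> x y" m] by simp
  also have "\<dots> = (\<integral>z. normal_density 0 \<sigma> z * (q * max 0 ((m - x) + z) + (1 - q) * ((m - x) + z))
      + normal_density 0 \<sigma> z * (x - \<kappa>) \<partial>lborel)"
  proof (rule Bochner_Integration.integral_cong[OF refl])
    fix z
    have "u2 q \<kappa> x (m + z) = q * max 0 ((m - x) + z) + (1 - q) * ((m - x) + z) + (x - \<kappa>)"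
      by (simp add: u2_def max_def algebra_simps)
    moreover have "normal_density m \<sigma> (m + z) = normal_density 0 \<sigma> z"
      by (simp add: normal_density_def)
    ultimately show "normal_density m \<sigma> (m + 1 * z) * u2 q \<kappa> x (m + 1 * z) =
        normal_density 0 \<sigma> z * (q * max 0 ((m - x) + z) + (1 - q) * ((m - x) + z))
        + normal_density 0 \<sigma> z * (x - \<kappa>)"
      by (simp add: distrib_left)
  qed
  also have "\<dots> = excess \<sigma> q (m - x) + (x - \<kappa>)"
    using excess_integrable[OF assms] assms(1)
    by (subst Bochner_Integration.integral_add) (auto simp: excess_def)
  finally show ?thesis by simp
qed

lemma strategy_sets:
  assumes "is_strategy S"
  shows "{x. S x = Continue} \<in> sets borel" "{x. S x = Stop} \<in> sets borel"
  using assms measurable_sets[of S borel "count_space UNIV" "{c}" for c]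
  unfolding is_strategy_def by (auto simp: vimage_def)

text \<open>The threshold rule \<open>T\<close> continues exactly where the conditional gain
  \<open>D\<close> is positive, so it is pointwise at least as good as \<open>S\<close>. Optimality
  of \<open>S\<close> forces the two to have equal value almost everywhere, hence to agree wherever
  \<open>D\<close> is nonzero.\<close>

lemma optimal_strategy_cutoff_rule:
  fixes \<sigma> :: real
  assumes s: "\<sigma> > 0" "0 \<le> q" "q < 1" and opt: "optimal_strategy q \<kappa> (\<Psi> \<sigma> \<mu>1 \<mu>2 \<gamma>) S"
    and y: "excess \<sigma> q y = \<kappa>" and g: "\<gamma> \<noteq> -1"
  shows "AE x in lborel. S x = Continue \<longleftrightarrow> (1 + \<gamma>) * x < \<mu>2 + \<gamma> * \<mu>1 - y"
proof -
  define D where "D = (\<lambda>x. excess \<sigma> q (\<mu>2 - \<gamma> * (x - \<mu>1) - x) - \<kappa>)"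
  define T where "T = (\<lambda>x. if (1 + \<gamma>) * x < \<mu>2 + \<gamma> * \<mu>1 - y then Continue else Stop)"
  \<comment> \<open>By strict monotonicity of \<open>excess\<close>, the gain is positive iff the
    mean of X2 - x exceeds y; collecting x gives the slope 1 + \<gamma>.\<close>
  have Dpos: "D x > 0 \<longleftrightarrow> T x = Continue" for x
    using excess_less_iff[OF s, of y "\<mu>2 - \<gamma> * (x - \<mu>1) - x"]
    by (simp add: D_def T_def y algebra_simps)
  have T: "is_strategy T" unfolding is_strategy_def T_def by measurable
  have S: "is_strategy S" using opt by (simp add: optimal_strategy_def)
  have val: "integral\<^sup>L (\<Psi> \<sigma> \<mu>1 \<mu>2 \<gamma>) (payoff q \<kappa> U) =
        (\<integral>x. normal_density \<mu>1 \<sigma> x * (x + (if U x = Continue then D x else 0)) \<partial>lborel)"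
    and ival: "integrable lborel
        (\<lambda>x. normal_density \<mu>1 \<sigma> x * (x + (if U x = Continue then D x else 0)))"
    if "is_strategy U" for U
  proof -
    note [measurable] = strategy_sets[OF that]
    have P: "payoff q \<kappa> U = (\<lambda>w. if fst w \<in> {x. U x = Continue} then u2 q \<kappa> (fst w) (snd w) else fst w)"
      by (auto simp: payoff_def u1_def fun_eq_iff split: choice.splits)
    have m: "payoff q \<kappa> U \<in> borel_measurable (borel \<Otimes>\<^sub>M borel)"
      unfolding P u2_def by measurable
    have b: "\<bar>payoff q \<kappa> U (x, z)\<bar> \<le> (3 + \<bar>\<kappa>\<bar>) * (1 + x\<^sup>2 + z\<^sup>2)" for x z
    proof (cases "U x")
      case Stop
      have "\<bar>x\<bar> \<le> 1 + x\<^sup>2"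
        by (rule abs_le_one_plus_square)
      also have "\<dots> \<le> 1 * (1 + x\<^sup>2 + z\<^sup>2)" by simp
      also have "\<dots> \<le> (3 + \<bar>\<kappa>\<bar>) * (1 + x\<^sup>2 + z\<^sup>2)" by (intro mult_right_mono) auto
      finally show ?thesis using Stop by (simp add: payoff_def u1_def)
    qed (simp add: payoff_def u2_bound[OF s(2,3)])
    have inner: "(\<integral>z. normal_density (\<mu>2 - \<gamma> * (x - \<mu>1)) \<sigma> z * payoff q \<kappa> U (x, z) \<partial>lborel)
        = x + (if U x = Continue then D x else 0)" for x
      using continuation_value[OF s, of "\<mu>2 - \<gamma> * (x - \<mu>1)" \<kappa> x] s(1)
      by (cases "U x") (simp_all add: payoff_def u1_def D_def)
    show "integral\<^sup>L (\<Psi> \<sigma> \<mu>1 \<mu>2 \<gamma>) (payoff q \<kappa> U) =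
        (\<integral>x. normal_density \<mu>1 \<sigma> x * (x + (if U x = Continue then D x else 0)) \<partial>lborel)"
      using integral_\<Psi>[OF s(1) m b] by (simp add: inner)
    show "integrable lborel
        (\<lambda>x. normal_density \<mu>1 \<sigma> x * (x + (if U x = Continue then D x else 0)))"
      using integrable_\<Psi>_fst[OF s(1) m b, of \<mu>1 \<mu>2 \<gamma>] by (simp add: inner)
  qed
  define L where "L = (\<lambda>x. normal_density \<mu>1 \<sigma> x * (x + (if T x = Continue then D x else 0))
    - normal_density \<mu>1 \<sigma> x * (x + (if S x = Continue then D x else 0)))"
  have L: "integrable lborel L" unfolding L_def by (intro Bochner_Integration.integrable_diff ival T S)
  have L': "L x = normal_density \<mu>1 \<sigma> x *
      ((if T x = Continue then D x else 0) - (if S x = Continue then D x else 0))" for x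
    by (simp add: L_def algebra_simps)
  \<comment> \<open>\<open>T\<close> collects max (D x) 0, while \<open>S\<close> collects either D
    x or 0.\<close>
  have L0: "L x \<ge> 0" for x
    unfolding L' using Dpos[of x] by (intro mult_nonneg_nonneg) auto
  have "integral\<^sup>L lborel L \<le> 0"
  proof -
    have "integral\<^sup>L (\<Psi> \<sigma> \<mu>1 \<mu>2 \<gamma>) (payoff q \<kappa> T) \<le> integral\<^sup>L (\<Psi> \<sigma> \<mu>1 \<mu>2 \<gamma>) (payoff q \<kappa> S)"
      using opt T by (simp add: optimal_strategy_def)
    then show ?thesis
      unfolding L_def Bochner_Integration.integral_diff[OF ival[OF T] ival[OF S]]
      by (simp add: val[OF T] val[OF S])
  qed
  then have "integral\<^sup>L lborel L = 0" using L0 by (simp add: antisym)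
  then have ae: "AE x in lborel. L x = 0"
    using integral_nonneg_eq_0_iff_AE[OF L] L0 by simp
  \<comment> \<open>As 1 + \<gamma> is nonzero, indifference occurs at a single point, which is a
    null set.\<close>
  have "AE x in lborel. x \<noteq> (\<mu>2 + \<gamma> * \<mu>1 - y) / (1 + \<gamma>)" by (rule AE_lborel_singleton)
  with ae show ?thesis
  proof eventually_elim
    case (elim x)
    have "\<mu>2 - \<gamma> * (x - \<mu>1) - x \<noteq> y" using elim(2) g by (auto simp: field_simps)
    then have "D x \<noteq> 0"
      using excess_less_iff[OF s, of y "\<mu>2 - \<gamma> * (x - \<mu>1) - x"]
        excess_less_iff[OF s, of "\<mu>2 - \<gamma> * (x - \<mu>1) - x" y] by (auto simp: D_def y)
    moreover have "normal_density \<mu>1 \<sigma> x \<noteq> 0" using normal_density_pos[OF s(1), of \<mu>1 x] by simp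
    ultimately have "T x = Continue \<longleftrightarrow> S x = Continue"
      using elim(1) unfolding L' by (auto split: if_splits)
    then show ?case by (simp add: T_def split: if_splits)
  qed
qed

subsection \<open>Kullback-Leibler divergence of history laws\<close>

lemma space_option_borel [simp]: "space option_borel = UNIV"
  by (simp add: option_borel_def)

lemma sets_option_borel:
  "sets option_borel = sigma_sets UNIV (insert {None} ((`) Some ` sets borel))"
  by (simp add: option_borel_def)

lemma measurable_Some [measurable]: "Some \<in> borel \<rightarrow>\<^sub>M option_borel"
proof -
  have "Some -` {None} = ({} :: real set)" by auto
  then show ?thesis
    unfolding option_borel_def
    by (intro measurable_measure_of) (auto simp: inj_vimage_image_eq)
qed

lemma sets_None [measurable]: "{None} \<in> sets option_borel"
  by (simp add: sets_option_borel sigma_sets.Basic)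

lemma measurable_the [measurable]: "the \<in> option_borel \<rightarrow>\<^sub>M borel"
proof (rule measurableI)
  fix B :: "real set" assume "B \<in> sets borel"
  then have *: "Some ` B \<in> sets option_borel"
    by (auto simp: sets_option_borel intro!: sigma_sets.Basic)
  have "the -` B = Some ` B \<or> the -` B = Some ` B \<union> {None}"
  proof (cases "(the None :: real) \<in> B")
    case True
    have "the -` B = Some ` B \<union> {None}"
    proof (rule set_eqI)
      show "z \<in> the -` B \<longleftrightarrow> z \<in> Some ` B \<union> {None}" for z :: "real option"
        using True by (cases z) auto
    qed
    then show ?thesis ..
  next
    case False
    have "the -` B = Some ` B"
    proof (rule set_eqI)
      show "z \<in> the -` B \<longleftrightarrow> z \<in> Some ` B" for z :: "real option"
        using False by (cases z) auto
    qed
    then show ?thesis ..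
  qed
  then show "the -` B \<inter> space option_borel \<in> sets option_borel"
    using * sets.Un[OF * sets_None] by auto
qed simp

lemma measurable_history [measurable]:
  assumes "is_strategy S"
  shows "history S \<in> borel \<Otimes>\<^sub>M borel \<rightarrow>\<^sub>M borel \<Otimes>\<^sub>M option_borel"
proof -
  note [measurable] = strategy_sets[OF assms]
  have *: "history S = (\<lambda>w. (fst w, if fst w \<in> {x. S x = Continue} then Some (snd w) else None))"
    by (auto simp: history_def fun_eq_iff split: choice.splits)
  show ?thesis unfolding * by measurable
qed

section \<open>Integration against the joint law and the history law\<close>

lemma sets_\<Psi> [measurable_cong, simp]: "sets (\<Psi> \<sigma> \<mu>1 \<mu>2 \<gamma>) = sets (borel \<Otimes>\<^sub>M borel)"
  unfolding \<Psi>_def by (simp cong: sets_pair_measure_cong)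

lemma nn_integral_\<Psi>:
  assumes [measurable]: "F \<in> borel_measurable (borel \<Otimes>\<^sub>M borel)"
  shows "integral\<^sup>N (\<Psi> \<sigma> \<mu>1 \<mu>2 \<gamma>) F = (\<integral>\<^sup>+x. \<integral>\<^sup>+y.
    ennreal (normal_density \<mu>1 \<sigma> x) * (ennreal (normal_density (\<mu>2 - \<gamma> * (x - \<mu>1)) \<sigma> y) * F (x, y)) \<partial>lborel \<partial>lborel)"
proof -
  have "integral\<^sup>N (\<Psi> \<sigma> \<mu>1 \<mu>2 \<gamma>) F = (\<integral>\<^sup>+w. (case w of (x, y) \<Rightarrow>
      ennreal (normal_density \<mu>1 \<sigma> x * normal_density (\<mu>2 - \<gamma> * (x - \<mu>1)) \<sigma> y)) * F w
      \<partial>(lborel \<Otimes>\<^sub>M lborel))"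
    unfolding \<Psi>_def by (rule nn_integral_density) measurable
  also have "\<dots> = (\<integral>\<^sup>+x. \<integral>\<^sup>+y. (case (x, y) of (x, y) \<Rightarrow>
      ennreal (normal_density \<mu>1 \<sigma> x * normal_density (\<mu>2 - \<gamma> * (x - \<mu>1)) \<sigma> y)) * F (x, y) \<partial>lborel \<partial>lborel)"
    by (rule lborel.nn_integral_fst[symmetric]) measurable
  finally show ?thesis by (simp add: ennreal_mult mult.assoc)
qed

lemma nn_integral_normal_density:
  fixes \<sigma> :: real
  assumes "\<sigma> > 0"
  shows "(\<integral>\<^sup>+y. ennreal (normal_density m \<sigma> y) \<partial>lborel) = 1"
  using assms by (simp add: nn_integral_eq_integral)

text \<open>Where the strategy stops, the history does not depend on X2, whose conditional density
  integrates to 1 and drops out.\<close>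

lemma nn_integral_history_law:
  fixes \<sigma> :: real
  assumes s: "\<sigma> > 0" and S: "is_strategy S"
    and [measurable]: "F \<in> borel_measurable (borel \<Otimes>\<^sub>M option_borel)"
  shows "integral\<^sup>N (history_law (\<Psi> \<sigma> \<mu>1 \<mu>2 \<gamma>) S) F = (\<integral>\<^sup>+x. ennreal (normal_density \<mu>1 \<sigma> x) *
    (if S x = Stop then F (x, None) else
      \<integral>\<^sup>+y. ennreal (normal_density (\<mu>2 - \<gamma> * (x - \<mu>1)) \<sigma> y) * F (x, Some y) \<partial>lborel) \<partial>lborel)"
proof -
  note [measurable] = measurable_history[OF S]
  have "integral\<^sup>N (history_law (\<Psi> \<sigma> \<mu>1 \<mu>2 \<gamma>) S) F = integral\<^sup>N (\<Psi> \<sigma> \<mu>1 \<mu>2 \<gamma>) (\<lambda>w. F (history S w))"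
    unfolding history_law_def by (rule nn_integral_distr) measurable
  also have "\<dots> = (\<integral>\<^sup>+x. \<integral>\<^sup>+y. ennreal (normal_density \<mu>1 \<sigma> x) *
      (ennreal (normal_density (\<mu>2 - \<gamma> * (x - \<mu>1)) \<sigma> y) * F (history S (x, y))) \<partial>lborel \<partial>lborel)"
    by (rule nn_integral_\<Psi>) measurable
  also have "\<dots> = (\<integral>\<^sup>+x. ennreal (normal_density \<mu>1 \<sigma> x) *
    (if S x = Stop then F (x, None) else
      \<integral>\<^sup>+y. ennreal (normal_density (\<mu>2 - \<gamma> * (x - \<mu>1)) \<sigma> y) * F (x, Some y) \<partial>lborel) \<partial>lborel)"
  proof (rule nn_integral_cong)
    fix x :: real
    show "(\<integral>\<^sup>+y. ennreal (normal_density \<mu>1 \<sigma> x) *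
      (ennreal (normal_density (\<mu>2 - \<gamma> * (x - \<mu>1)) \<sigma> y) * F (history S (x, y))) \<partial>lborel)
      = ennreal (normal_density \<mu>1 \<sigma> x) * (if S x = Stop then F (x, None) else
      \<integral>\<^sup>+y. ennreal (normal_density (\<mu>2 - \<gamma> * (x - \<mu>1)) \<sigma> y) * F (x, Some y) \<partial>lborel)"
      using nn_integral_normal_density[OF s]
      by (cases "S x") (simp_all add: history_def nn_integral_cmult nn_integral_multc)
  qed
  finally show ?thesis .
qed

section \<open>Log-likelihood ratios and the divergence\<close>

definition normal_llr :: "real \<Rightarrow> real \<Rightarrow> real \<Rightarrow> real \<Rightarrow> real" where
  "normal_llr \<sigma> m m' x = ((x - m)\<^sup>2 - (x - m')\<^sup>2) / (2 * \<sigma>\<^sup>2)"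

text \<open>With equal variances the normalizing constants cancel, so \<open>normal_llr\<close> is
  the logarithm of the density with mean m' over the density with mean m.\<close>

lemma normal_density_times_exp_llr:
  fixes \<sigma> :: real
  assumes "\<sigma> > 0"
  shows "normal_density m \<sigma> x * exp (normal_llr \<sigma> m m' x) = normal_density m' \<sigma> x"
proof -
  have "exp (- (x - m)\<^sup>2 / (2 * \<sigma>\<^sup>2)) * exp (normal_llr \<sigma> m m' x) = exp (- (x - m')\<^sup>2 / (2 * \<sigma>\<^sup>2))"
    unfolding exp_add[symmetric] normal_llr_def by (simp add: diff_divide_distrib)
  then show ?thesis by (simp add: normal_density_def)
qed

text \<open>This is the divergence of N(m', \<sigma>^2) relative to N(m, \<sigma>^2). The terms x^2
  cancel in the log-ratio, which is therefore affine and integrates to its value at the mean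
  m'.\<close>

lemma normal_llr_integral:
  fixes \<sigma> :: real
  assumes "\<sigma> > 0"
  shows "has_bochner_integral lborel (\<lambda>x. normal_density m' \<sigma> x * normal_llr \<sigma> m m' x)
    ((m - m')\<^sup>2 / (2 * \<sigma>\<^sup>2))"
proof -
  have "has_bochner_integral lborel
      (\<lambda>x. normal_density m' \<sigma> x * ((m\<^sup>2 - m'\<^sup>2) / (2 * \<sigma>\<^sup>2) + ((m' - m) / \<sigma>\<^sup>2) * x + 0 * x\<^sup>2))
      ((m\<^sup>2 - m'\<^sup>2) / (2 * \<sigma>\<^sup>2) + ((m' - m) / \<sigma>\<^sup>2) * m' + 0 * (m'\<^sup>2 + \<sigma>\<^sup>2))"
    by (rule normal_quadratic[OF assms])
  moreover have "normal_llr \<sigma> m m' x = (m\<^sup>2 - m'\<^sup>2) / (2 * \<sigma>\<^sup>2) + ((m' - m) / \<sigma>\<^sup>2) * x + 0 * x\<^sup>2" for x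
    using assms by (simp add: normal_llr_def field_simps power2_eq_square)
  moreover have "(m\<^sup>2 - m'\<^sup>2) / (2 * \<sigma>\<^sup>2) + ((m' - m) / \<sigma>\<^sup>2) * m' + 0 * (m'\<^sup>2 + \<sigma>\<^sup>2)
      = (m - m')\<^sup>2 / (2 * \<sigma>\<^sup>2)"
    using assms by (simp add: field_simps power2_eq_square)
  ultimately show ?thesis by (simp only:)
qed

text \<open>Logarithm of the primed over the unprimed likelihood of a history: the X1 term, plus the
  conditional X2 term when X2 is observed.\<close>

definition history_llr where
  "history_llr \<sigma> \<mu>1 \<mu>2 \<gamma> \<mu>1' \<mu>2' \<gamma>' = (\<lambda>h. normal_llr \<sigma> \<mu>1 \<mu>1' (fst h) +
    (if snd h = None then 0
     else normal_llr \<sigma> (\<mu>2 - \<gamma> * (fst h - \<mu>1)) (\<mu>2' - \<gamma>' * (fst h - \<mu>1')) (the (snd h))))"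

lemma measurable_history_llr [measurable]:
  "history_llr \<sigma> \<mu>1 \<mu>2 \<gamma> \<mu>1' \<mu>2' \<gamma>' \<in> borel_measurable (borel \<Otimes>\<^sub>M option_borel)"
proof -
  have "(\<lambda>h. snd h \<in> {None}) \<in> borel \<Otimes>\<^sub>M option_borel \<rightarrow>\<^sub>M count_space (UNIV :: bool set)"
    by measurable
  then have [measurable]: "(\<lambda>h. snd h = None) \<in> borel \<Otimes>\<^sub>M option_borel \<rightarrow>\<^sub>M count_space (UNIV :: bool set)"
    by simp
  show ?thesis unfolding history_llr_def normal_llr_def by measurable
qed

text \<open>Both laws are censored on the same region, so the density ratio factors into the ratio
  for X1 and, on the continuation region, the ratio for X2 given X1.\<close>

lemma history_law_density:
  fixes \<sigma> :: real
  assumes s: "\<sigma> > 0" and S: "is_strategy S"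
  shows "history_law (\<Psi> \<sigma> \<mu>1' \<mu>2' \<gamma>') S = density (history_law (\<Psi> \<sigma> \<mu>1 \<mu>2 \<gamma>) S)
    (\<lambda>h. ennreal (exp (history_llr \<sigma> \<mu>1 \<mu>2 \<gamma> \<mu>1' \<mu>2' \<gamma>' h)))"
    (is "?P = density ?Q ?g")
proof (rule measure_eqI)
  show sets: "sets ?P = sets (density ?Q ?g)" by (simp add: history_law_def)
  fix B assume "B \<in> sets ?P"
  then have B[measurable]: "B \<in> sets (borel \<Otimes>\<^sub>M option_borel)" by (simp add: history_law_def)
  have Q: "sets ?Q = sets (borel \<Otimes>\<^sub>M option_borel)" by (simp add: history_law_def)
  have B': "B \<in> sets ?Q" by (simp add: Q)
  have gm: "?g \<in> borel_measurable ?Q" by (subst measurable_cong_sets[OF Q refl]) measurable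
  let ?m = "\<lambda>x. \<mu>2 - \<gamma> * (x - \<mu>1)" and ?m' = "\<lambda>x. \<mu>2' - \<gamma>' * (x - \<mu>1')"
  have "emeasure (density ?Q ?g) B = (\<integral>\<^sup>+h. ?g h * indicator B h \<partial>?Q)"
    by (rule emeasure_density[OF gm B'])
  also have "\<dots> = (\<integral>\<^sup>+x. ennreal (normal_density \<mu>1 \<sigma> x) * (if S x = Stop
      then ?g (x, None) * indicator B (x, None) else
      \<integral>\<^sup>+y. ennreal (normal_density (?m x) \<sigma> y) * (?g (x, Some y) * indicator B (x, Some y)) \<partial>lborel) \<partial>lborel)"
    by (rule nn_integral_history_law[OF s S]) measurable
  also have "\<dots> = (\<integral>\<^sup>+x. ennreal (normal_density \<mu>1' \<sigma> x) * (if S x = Stop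
      then indicator B (x, None) else
      \<integral>\<^sup>+y. ennreal (normal_density (?m' x) \<sigma> y) * indicator B (x, Some y) \<partial>lborel) \<partial>lborel)"
  proof (rule nn_integral_cong)
    fix x :: real
    let ?e = "ennreal (exp (normal_llr \<sigma> \<mu>1 \<mu>1' x))"
    have 1: "ennreal (normal_density \<mu>1 \<sigma> x) * ?e = ennreal (normal_density \<mu>1' \<sigma> x)"
      by (simp add: ennreal_mult[symmetric] normal_density_times_exp_llr[OF s])
    show "ennreal (normal_density \<mu>1 \<sigma> x) * (if S x = Stop
      then ?g (x, None) * indicator B (x, None) else
      \<integral>\<^sup>+y. ennreal (normal_density (?m x) \<sigma> y) * (?g (x, Some y) * indicator B (x, Some y)) \<partial>lborel)
      = ennreal (normal_density \<mu>1' \<sigma> x) * (if S x = Stop then indicator B (x, None) else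
      \<integral>\<^sup>+y. ennreal (normal_density (?m' x) \<sigma> y) * indicator B (x, Some y) \<partial>lborel)"
    proof (cases "S x")
      case Stop
      then show ?thesis by (simp add: history_llr_def 1[symmetric] mult.assoc)
    next
      case Continue
      have "ennreal (normal_density (?m x) \<sigma> y) * (?g (x, Some y) * indicator B (x, Some y))
          = ?e * (ennreal (normal_density (?m' x) \<sigma> y) * indicator B (x, Some y))" for y
      proof -
        have "ennreal (normal_density (?m' x) \<sigma> y) = ennreal (normal_density (?m x) \<sigma> y)
            * ennreal (exp (normal_llr \<sigma> (?m x) (?m' x) y))"
          by (simp add: ennreal_mult[symmetric] normal_density_times_exp_llr[OF s])
        then show ?thesis by (simp add: history_llr_def exp_add ennreal_mult ac_simps)
      qed
      moreover have "(\<integral>\<^sup>+y. ?e * (ennreal (normal_density (?m' x) \<sigma> y) * indicator B (x, Some y)) \<partial>lborel)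
          = ?e * (\<integral>\<^sup>+y. ennreal (normal_density (?m' x) \<sigma> y) * indicator B (x, Some y) \<partial>lborel)"
        by (rule nn_integral_cmult) measurable
      ultimately show ?thesis using Continue by (simp add: 1[symmetric] mult.assoc)
    qed
  qed
  also have "\<dots> = (\<integral>\<^sup>+h. indicator B h \<partial>?P)"
    by (rule nn_integral_history_law[OF s S, symmetric]) measurable
  also have "\<dots> = emeasure ?P B" by (rule nn_integral_indicator) fact
  finally show "emeasure ?P B = emeasure (density ?Q ?g) B" by simp
qed

lemma prob_space_\<Psi>:
  fixes \<sigma> :: real
  assumes "\<sigma> > 0"
  shows "prob_space (\<Psi> \<sigma> \<mu>1 \<mu>2 \<gamma>)"
proof
  have "emeasure (\<Psi> \<sigma> \<mu>1 \<mu>2 \<gamma>) (space (\<Psi> \<sigma> \<mu>1 \<mu>2 \<gamma>)) = (\<integral>\<^sup>+w. 1 \<partial>\<Psi> \<sigma> \<mu>1 \<mu>2 \<gamma>)" by simp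
  also have "\<dots> = 1"
    using nn_integral_normal_density[OF assms]
    by (subst nn_integral_\<Psi>) (simp_all add: nn_integral_cmult)
  finally show "emeasure (\<Psi> \<sigma> \<mu>1 \<mu>2 \<gamma>) (space (\<Psi> \<sigma> \<mu>1 \<mu>2 \<gamma>)) = 1" .
qed

text \<open>Chain rule for the divergence: X1 contributes the squared error of its mean, and X2
  given X1 = x contributes the squared error of the conditional mean, counted only where X2 is
  observed.\<close>

lemma KL_history_law:
  fixes \<sigma> :: real
  assumes s: "\<sigma> > 0" and S: "is_strategy S"
  shows "KL_divergence (exp 1) (history_law (\<Psi> \<sigma> \<mu>1 \<mu>2 \<gamma>) S) (history_law (\<Psi> \<sigma> \<mu>1' \<mu>2' \<gamma>') S)
    = ((\<mu>1 - \<mu>1')\<^sup>2 + (\<integral>x. normal_density \<mu>1' \<sigma> x * (indicator {x. S x = Continue} x *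
        ((\<mu>2 - \<gamma> * (x - \<mu>1)) - (\<mu>2' - \<gamma>' * (x - \<mu>1')))\<^sup>2) \<partial>lborel)) / (2 * \<sigma>\<^sup>2)"
proof -
  let ?P = "history_law (\<Psi> \<sigma> \<mu>1' \<mu>2' \<gamma>') S" and ?Q = "history_law (\<Psi> \<sigma> \<mu>1 \<mu>2 \<gamma>) S"
  let ?l = "history_llr \<sigma> \<mu>1 \<mu>2 \<gamma> \<mu>1' \<mu>2' \<gamma>'"
  let ?m = "\<lambda>x. \<mu>2 - \<gamma> * (x - \<mu>1)" and ?m' = "\<lambda>x. \<mu>2' - \<gamma>' * (x - \<mu>1')"
  note [measurable] = measurable_history[OF S] strategy_sets[OF S]
  have sets: "sets ?Q = sets (borel \<Otimes>\<^sub>M option_borel)" for \<mu>1 \<mu>2 \<gamma> by (simp add: history_law_def)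
  have lm: "?l \<in> borel_measurable ?Q" by (subst measurable_cong_sets[OF sets refl]) measurable
  interpret Q: prob_space ?Q
    unfolding history_law_def
    by (rule prob_space.prob_space_distr[OF prob_space_\<Psi>[OF s]]) measurable
  \<comment> \<open>Writing the true law \<open>?P\<close> with density exp l relative to
    \<open>?Q\<close> gives the integral of l exp l under \<open>?Q\<close>, which is the integral
    of l under \<open>?P\<close>.\<close>
  have "KL_divergence (exp 1) ?Q ?P = (\<integral>h. exp (?l h) * log (exp 1) (exp (?l h)) \<partial>?Q)"
    unfolding history_law_density[OF s S, of \<mu>1' \<mu>2' \<gamma>' \<mu>1 \<mu>2 \<gamma>]
    using lm by (intro Q.KL_density) auto
  also have "\<dots> = (\<integral>h. exp (?l h) *\<^sub>R ?l h \<partial>?Q)" by (simp add: log_def)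
  also have "\<dots> = (\<integral>h. ?l h \<partial>?P)"
    unfolding history_law_density[OF s S, of \<mu>1' \<mu>2' \<gamma>' \<mu>1 \<mu>2 \<gamma>]
    using lm by (intro integral_density[symmetric]) auto
  also have "\<dots> = (\<integral>w. ?l (history S w) \<partial>\<Psi> \<sigma> \<mu>1' \<mu>2' \<gamma>')"
    unfolding history_law_def by (rule integral_distr) measurable
  also have "\<dots> = (\<integral>x. normal_density \<mu>1' \<sigma> x *
      (\<integral>y. normal_density (?m' x) \<sigma> y * ?l (history S (x, y)) \<partial>lborel) \<partial>lborel)"
  proof (rule integral_\<Psi>[OF s])
    show "(\<lambda>w. ?l (history S w)) \<in> borel_measurable (borel \<Otimes>\<^sub>M borel)" by measurable
    have q: "\<bar>normal_llr \<sigma> a b t\<bar> \<le> (2 * a\<^sup>2 + 2 * b\<^sup>2 + 4 * t\<^sup>2) / (2 * \<sigma>\<^sup>2)" for a b t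
    proof -
      have "\<bar>(t - a)\<^sup>2 - (t - b)\<^sup>2\<bar> \<le> (t - a)\<^sup>2 + (t - b)\<^sup>2"
        using abs_triangle_ineq4[of "(t - a)\<^sup>2" "(t - b)\<^sup>2"] by simp
      also have "\<dots> \<le> 2 * a\<^sup>2 + 2 * b\<^sup>2 + 4 * t\<^sup>2"
        using affine_square_bound[of a 1 t] affine_square_bound[of b 1 t] by (simp add: power2_commute)
      finally show ?thesis using s by (simp add: normal_llr_def abs_divide divide_right_mono)
    qed
    have m: "(a - c * (t - b))\<^sup>2 \<le> 2 * (a + c * b)\<^sup>2 + 2 * c\<^sup>2 * t\<^sup>2" for a b c t :: real
      using affine_square_bound[of "a + c * b" c t] by (simp add: algebra_simps)
    \<comment> \<open>The coefficients 4 arise from applying the square bound to 2 (?m x)^2 and 2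
      (?m' x)^2; the summand 8 absorbs 4 x^2 and 4 y^2.\<close>
    define K where "K = (2 * \<mu>1\<^sup>2 + 2 * \<mu>1'\<^sup>2 + 4 * (\<mu>2 + \<gamma> * \<mu>1)\<^sup>2 + 4 * (\<mu>2' + \<gamma>' * \<mu>1')\<^sup>2
      + 4 * \<gamma>\<^sup>2 + 4 * \<gamma>'\<^sup>2 + 8) / (2 * \<sigma>\<^sup>2)"
    fix x y :: real
    have "\<bar>?l (history S (x, y))\<bar> \<le> \<bar>normal_llr \<sigma> \<mu>1 \<mu>1' x\<bar> + \<bar>normal_llr \<sigma> (?m x) (?m' x) y\<bar>"
      by (cases "S x") (auto simp: history_llr_def history_def abs_triangle_ineq)
    also have "\<dots> \<le> (2 * \<mu>1\<^sup>2 + 2 * \<mu>1'\<^sup>2 + 4 * x\<^sup>2) / (2 * \<sigma>\<^sup>2)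
        + (2 * (?m x)\<^sup>2 + 2 * (?m' x)\<^sup>2 + 4 * y\<^sup>2) / (2 * \<sigma>\<^sup>2)"
      by (intro add_mono q)
    also have "\<dots> = (2 * \<mu>1\<^sup>2 + 2 * \<mu>1'\<^sup>2 + 4 * x\<^sup>2 + 2 * (?m x)\<^sup>2 + 2 * (?m' x)\<^sup>2 + 4 * y\<^sup>2) / (2 * \<sigma>\<^sup>2)"
      by (simp add: add_divide_distrib)
    also have "\<dots> \<le> ((2 * \<mu>1\<^sup>2 + 2 * \<mu>1'\<^sup>2 + 4 * (\<mu>2 + \<gamma> * \<mu>1)\<^sup>2 + 4 * (\<mu>2' + \<gamma>' * \<mu>1')\<^sup>2
        + 4 * \<gamma>\<^sup>2 + 4 * \<gamma>'\<^sup>2 + 8) * (1 + x\<^sup>2 + y\<^sup>2)) / (2 * \<sigma>\<^sup>2)"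
    proof (rule divide_right_mono)
      let ?c = "2 * \<mu>1\<^sup>2 + 2 * \<mu>1'\<^sup>2 + 4 * (\<mu>2 + \<gamma> * \<mu>1)\<^sup>2 + 4 * (\<mu>2' + \<gamma>' * \<mu>1')\<^sup>2"
      let ?d = "4 * \<gamma>\<^sup>2 + 4 * \<gamma>'\<^sup>2"
      have "2 * \<mu>1\<^sup>2 + 2 * \<mu>1'\<^sup>2 + 4 * x\<^sup>2 + 2 * (?m x)\<^sup>2 + 2 * (?m' x)\<^sup>2 + 4 * y\<^sup>2
          \<le> ?c * 1 + ?d * x\<^sup>2 + 4 * x\<^sup>2 + 4 * y\<^sup>2"
        using m[of \<mu>2 \<gamma> x \<mu>1] m[of \<mu>2' \<gamma>' x \<mu>1'] by (simp add: distrib_right)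
      also have "\<dots> \<le> ?c * (1 + x\<^sup>2 + y\<^sup>2) + ?d * (1 + x\<^sup>2 + y\<^sup>2) + 4 * (1 + x\<^sup>2 + y\<^sup>2) + 4 * (1 + x\<^sup>2 + y\<^sup>2)"
        by (intro add_mono mult_left_mono) auto
      finally show "2 * \<mu>1\<^sup>2 + 2 * \<mu>1'\<^sup>2 + 4 * x\<^sup>2 + 2 * (?m x)\<^sup>2 + 2 * (?m' x)\<^sup>2 + 4 * y\<^sup>2
          \<le> (?c + 4 * \<gamma>\<^sup>2 + 4 * \<gamma>'\<^sup>2 + 8) * (1 + x\<^sup>2 + y\<^sup>2)"
        by (simp add: algebra_simps)
    qed simp
    finally show "\<bar>?l (history S (x, y))\<bar> \<le> K * (1 + x\<^sup>2 + y\<^sup>2)" by (simp add: K_def)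
  qed
  also have "\<dots> = (\<integral>x. normal_density \<mu>1' \<sigma> x * normal_llr \<sigma> \<mu>1 \<mu>1' x
      + normal_density \<mu>1' \<sigma> x * (indicator {x. S x = Continue} x * (?m x - ?m' x)\<^sup>2) / (2 * \<sigma>\<^sup>2) \<partial>lborel)"
  proof (rule Bochner_Integration.integral_cong[OF refl])
    fix x :: real
    have "(\<integral>y. normal_density (?m' x) \<sigma> y * ?l (history S (x, y)) \<partial>lborel)
        = normal_llr \<sigma> \<mu>1 \<mu>1' x + indicator {x. S x = Continue} x * (?m x - ?m' x)\<^sup>2 / (2 * \<sigma>\<^sup>2)"
    proof (cases "S x")
      case Stop
      then show ?thesis using s by (simp add: history_llr_def history_def)
    next
      case Continue
      have "has_bochner_integral lborel (\<lambda>y. normal_density (?m' x) \<sigma> y * normal_llr \<sigma> \<mu>1 \<mu>1' x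
          + normal_density (?m' x) \<sigma> y * normal_llr \<sigma> (?m x) (?m' x) y)
          (1 * normal_llr \<sigma> \<mu>1 \<mu>1' x + (?m x - ?m' x)\<^sup>2 / (2 * \<sigma>\<^sup>2))"
        using s by (intro has_bochner_integral_add has_bochner_integral_mult_left normal_llr_integral)
          (auto simp: has_bochner_integral_iff)
      then show ?thesis
        using Continue by (simp add: history_llr_def history_def distrib_left has_bochner_integral_iff)
    qed
    then show "normal_density \<mu>1' \<sigma> x * (\<integral>y. normal_density (?m' x) \<sigma> y * ?l (history S (x, y)) \<partial>lborel)
      = normal_density \<mu>1' \<sigma> x * normal_llr \<sigma> \<mu>1 \<mu>1' x
      + normal_density \<mu>1' \<sigma> x * (indicator {x. S x = Continue} x * (?m x - ?m' x)\<^sup>2) / (2 * \<sigma>\<^sup>2)"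
      by (simp add: distrib_left)
  qed
  also have "\<dots> = (\<mu>1 - \<mu>1')\<^sup>2 / (2 * \<sigma>\<^sup>2) + (\<integral>x. normal_density \<mu>1' \<sigma> x *
      (indicator {x. S x = Continue} x * (?m x - ?m' x)\<^sup>2) \<partial>lborel) / (2 * \<sigma>\<^sup>2)"
  proof -
    \<comment> \<open>The difference of the conditional means is affine in x, with intercept
      \<open>?a\<close> and slope \<gamma>' - \<gamma>.\<close>
    let ?a = "\<mu>2 + \<gamma> * \<mu>1 - \<mu>2' - \<gamma>' * \<mu>1'"
    have "integrable lborel (\<lambda>x. normal_density \<mu>1' \<sigma> x * (indicator {x. S x = Continue} x * (?m x - ?m' x)\<^sup>2))"
    proof (rule integrable_normal_quadratic_bound[OF s])
      fix x :: real
      have "\<bar>indicator {x. S x = Continue} x * (?m x - ?m' x)\<^sup>2\<bar> \<le> (?m x - ?m' x)\<^sup>2"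
        by (simp add: indicator_def)
      also have "\<dots> \<le> 2 * ?a\<^sup>2 + 2 * (\<gamma> - \<gamma>')\<^sup>2 * x\<^sup>2"
        using affine_square_bound[of ?a "\<gamma> - \<gamma>'" x] by (simp add: algebra_simps)
      also have "\<dots> \<le> (2 + 2 * (\<gamma> - \<gamma>')\<^sup>2) * (?a\<^sup>2 + x\<^sup>2)" by (simp add: algebra_simps)
      finally show "\<bar>indicator {x. S x = Continue} x * (?m x - ?m' x)\<^sup>2\<bar>
          \<le> (2 + 2 * (\<gamma> - \<gamma>')\<^sup>2) * (?a\<^sup>2 + x\<^sup>2)" .
    qed measurable
    then show ?thesis
      using normal_llr_integral[OF s, of \<mu>1' \<mu>1]
      by (subst Bochner_Integration.integral_add) (auto simp: has_bochner_integral_iff)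
  qed
  finally show ?thesis by (simp add: add_divide_distrib)
qed

subsection \<open>Pseudo-true parameters\<close>

text \<open>Left unnormalized: order 0 is the probability of A, and dividing by it gives moments
  conditional on A.\<close>

definition censored_moment :: "real \<Rightarrow> real \<Rightarrow> real set \<Rightarrow> nat \<Rightarrow> real" where
  "censored_moment \<mu> \<sigma> A k = (\<integral>x. normal_density \<mu> \<sigma> x * (indicator A x * x ^ k) \<partial>lborel)"

lemma censored_quadratic:
  fixes \<sigma> \<mu> :: real and A :: "real set"
  assumes "\<sigma> > 0" and A: "A \<in> sets borel"
  defines "M \<equiv> censored_moment \<mu> \<sigma> A"
  shows "has_bochner_integral lborel (\<lambda>x. normal_density \<mu> \<sigma> x * (indicator A x * (a + b * x + c * x\<^sup>2)))
    (a * M 0 + b * M 1 + c * M 2)"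
proof -
  have quad: "integrable lborel (\<lambda>x. normal_density \<mu> \<sigma> x * (indicator A x * (a + b * x + c * x\<^sup>2)))" for a b c
    using integrable_mult_indicator[OF _ integrable.intros[OF normal_quadratic[OF assms(1), of \<mu> a b c]], of A] A
    by (simp add: ac_simps)
  have M: "has_bochner_integral lborel (\<lambda>x. normal_density \<mu> \<sigma> x * (indicator A x * x ^ k)) (M k)"
    if "k \<in> {0, 1, 2}" for k
    using that quad[of 1 0 0] quad[of 0 1 0] quad[of 0 0 1]
    unfolding has_bochner_integral_iff M_def censored_moment_def by auto
  have "has_bochner_integral lborel (\<lambda>x. a * (normal_density \<mu> \<sigma> x * (indicator A x * x ^ 0))
      + b * (normal_density \<mu> \<sigma> x * (indicator A x * x ^ 1))
      + c * (normal_density \<mu> \<sigma> x * (indicator A x * x ^ 2))) (a * M 0 + b * M 1 + c * M 2)"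
    by (intro has_bochner_integral_add has_bochner_integral_mult_right M) auto
  then show ?thesis by (simp add: algebra_simps)
qed

text \<open>The normal density is positive everywhere, so an integrand positive almost everywhere on
  a set of positive Lebesgue measure cannot integrate to 0. This yields the positive mass, the
  positive variance and the position of the conditional mean relative to the cutoff.\<close>

lemma censored_integral_pos:
  fixes \<sigma> :: real
  assumes "\<sigma> > 0" and A: "A \<in> sets borel" "emeasure lborel A > 0"
    and i: "has_bochner_integral lborel (\<lambda>x. normal_density \<mu> \<sigma> x * (indicator A x * g x)) I"
    and pos: "AE x in lborel. x \<in> A \<longrightarrow> g x > 0"
  shows "I > 0"
proof -
  let ?h = "\<lambda>x. normal_density \<mu> \<sigma> x * (indicator A x * g x)"
  have nonneg: "AE x in lborel. 0 \<le> ?h x"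
    using pos by eventually_elim (auto simp: indicator_def)
  have "integral\<^sup>L lborel ?h \<noteq> 0"
  proof
    assume "integral\<^sup>L lborel ?h = 0"
    then have "AE x in lborel. ?h x = 0"
      using integral_nonneg_eq_0_iff_AE[OF _ nonneg] i by (simp add: has_bochner_integral_iff)
    with pos have "AE x in lborel. x \<notin> A"
    proof eventually_elim
      case (elim x)
      then show ?case using normal_density_pos[OF assms(1), of \<mu> x] by (auto simp: indicator_def)
    qed
    then have "emeasure lborel A = 0"
      using A(1) by (subst (asm) AE_iff_measurable[where N = A]) auto
    then show False using A(2) by simp
  qed
  moreover have "integral\<^sup>L lborel ?h \<ge> 0" by (rule integral_nonneg_AE[OF nonneg])
  ultimately show ?thesis using i by (simp add: has_bochner_integral_iff)
qed

text \<open>Up to a positive factor, the divergence is a sum of three nonnegative terms: the squared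
  error of \<mu>1, a squared residual of the conditional mean of X2 at X1 = E, and (\<gamma> - r)^2
  V. All three can be minimized at once, so a minimizer must minimize each.\<close>

lemma pseudo_true_parameters:
  fixes \<sigma> \<mu>1' :: real and S :: strategy
  assumes s: "\<sigma> > 0" and S: "is_strategy S" and cont: "continues_with_positive_probability S"
    and argmin: "is_arg_min (\<lambda>g. \<bar>g - r\<bar>) (\<lambda>g. g \<in> {\<gamma>l..\<gamma>h}) \<gamma>n"
    and pt: "pseudo_true \<sigma> \<mu>1' \<mu>2' r \<gamma>l \<gamma>h S (\<mu>1, \<mu>2, \<gamma>)"
  defines "M \<equiv> censored_moment \<mu>1' \<sigma> {x. S x = Continue}"
  shows "\<mu>1 = \<mu>1'" and "\<gamma> = \<gamma>n"
    and "M 0 * (\<mu>2 + \<gamma> * \<mu>1 - (\<mu>2' + r * \<mu>1')) = (\<gamma> - r) * M 1" and "M 0 > 0"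
proof -
  let ?A = "{x. S x = Continue}"
  have A: "?A \<in> sets borel" "emeasure lborel ?A > 0"
    using strategy_sets[OF S] cont by (auto simp: continues_with_positive_probability_def)
  note quad = censored_quadratic[OF s A(1), of \<mu>1', folded M_def]
  show p: "M 0 > 0"
  proof (rule censored_integral_pos[OF s A])
    show "has_bochner_integral lborel (\<lambda>x. normal_density \<mu>1' \<sigma> x * (indicator ?A x * 1)) (M 0)"
      using quad[of 1 0 0] by simp
  qed simp
  \<comment> \<open>\<open>E\<close> is the mean of X1 conditional on continuing, and
    \<open>V\<close> below is \<open>M 0\<close> times the conditional variance.\<close>
  define E where "E = M 1 / M 0"
  define V where "V = M 2 - E\<^sup>2 * M 0"
  have E: "M 1 = E * M 0" using p by (simp add: E_def)
  \<comment> \<open>bias-variance decomposition of the least-squares fit of \<open>d\<close> to \<open>g * X1\<close> on the continuation region\<close>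
  have sq: "has_bochner_integral lborel (\<lambda>x. normal_density \<mu>1' \<sigma> x * (indicator ?A x * (d - g * x)\<^sup>2))
      (M 0 * (d - g * E)\<^sup>2 + g\<^sup>2 * V)" for d g
  proof -
    have "(d - g * x)\<^sup>2 = d\<^sup>2 + (- 2 * d * g) * x + g\<^sup>2 * x\<^sup>2" for x
      by (simp add: power2_eq_square algebra_simps)
    moreover have "M 0 * (d - g * E)\<^sup>2 + g\<^sup>2 * V = d\<^sup>2 * M 0 + (- 2 * d * g) * M 1 + g\<^sup>2 * M 2"
      by (simp add: V_def E[unfolded One_nat_def] power2_eq_square algebra_simps)
    ultimately show ?thesis using quad[of "d\<^sup>2" "- 2 * d * g" "g\<^sup>2"] by (simp only:)
  qed
  have V: "V > 0"
  proof (rule censored_integral_pos[OF s A])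
    show "has_bochner_integral lborel (\<lambda>x. normal_density \<mu>1' \<sigma> x * (indicator ?A x * (E - 1 * x)\<^sup>2)) V"
      using sq[of E 1] by simp
    show "AE x in lborel. x \<in> ?A \<longrightarrow> 0 < (E - 1 * x)\<^sup>2"
      using AE_lborel_singleton[of E] by eventually_elim auto
  qed
  have KL: "KL_divergence (exp 1) (history_law (\<Psi> \<sigma> m1 m2 g) S) (history_law (\<Psi> \<sigma> \<mu>1' \<mu>2' r) S)
      = ((m1 - \<mu>1')\<^sup>2 + (M 0 * (m2 + g * m1 - (\<mu>2' + r * \<mu>1') - (g - r) * E)\<^sup>2 + (g - r)\<^sup>2 * V)) / (2 * \<sigma>\<^sup>2)"
    for m1 m2 g
  proof -
    have "(m2 - g * (x - m1)) - (\<mu>2' - r * (x - \<mu>1')) = (m2 + g * m1 - (\<mu>2' + r * \<mu>1')) - (g - r) * x" for x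
      by (simp add: algebra_simps)
    then show ?thesis
      using sq[of "m2 + g * m1 - (\<mu>2' + r * \<mu>1')" "g - r"]
      by (simp only: KL_history_law[OF s S] has_bochner_integral_iff)
  qed
  have n: "\<gamma>n \<in> {\<gamma>l..\<gamma>h}" "\<And>g. g \<in> {\<gamma>l..\<gamma>h} \<Longrightarrow> \<bar>\<gamma>n - r\<bar> \<le> \<bar>g - r\<bar>"
    using argmin by (auto simp: is_arg_min_linorder)
  have g: "\<gamma> \<in> {\<gamma>l..\<gamma>h}" using pt by (simp add: pseudo_true_def is_arg_min_def)
  \<comment> \<open>The competitor keeps the true \<mu>1' and takes the slope \<gamma>n; this second
    mean makes the residual at \<open>E\<close> vanish.\<close>
  let ?m2 = "\<mu>2' + r * \<mu>1' + (\<gamma>n - r) * E - \<gamma>n * \<mu>1'"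
  have "KL_divergence (exp 1) (history_law (\<Psi> \<sigma> \<mu>1 \<mu>2 \<gamma>) S) (history_law (\<Psi> \<sigma> \<mu>1' \<mu>2' r) S)
      \<le> KL_divergence (exp 1) (history_law (\<Psi> \<sigma> \<mu>1' ?m2 \<gamma>n) S) (history_law (\<Psi> \<sigma> \<mu>1' \<mu>2' r) S)"
    using pt n(1) by (auto simp: pseudo_true_def is_arg_min_linorder)
  then have le: "(\<mu>1 - \<mu>1')\<^sup>2 + (M 0 * (\<mu>2 + \<gamma> * \<mu>1 - (\<mu>2' + r * \<mu>1') - (\<gamma> - r) * E)\<^sup>2 + (\<gamma> - r)\<^sup>2 * V)
      \<le> (\<gamma>n - r)\<^sup>2 * V"
    using s unfolding KL by (simp add: divide_le_cancel)
  \<comment> \<open>The competitor shows that the three terms sum to at most (\<gamma>n - r)^2 V,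
    while the third alone is at least that; so the first two vanish and the third is equal to
    it.\<close>
  have sqle: "(\<gamma>n - r)\<^sup>2 \<le> (\<gamma> - r)\<^sup>2" using n(2)[OF g] by (simp add: abs_le_square_iff)
  then have Vle: "(\<gamma>n - r)\<^sup>2 * V \<le> (\<gamma> - r)\<^sup>2 * V" using V by (simp add: mult_right_mono)
  have nn: "0 \<le> (\<mu>1 - \<mu>1')\<^sup>2" "0 \<le> M 0 * (\<mu>2 + \<gamma> * \<mu>1 - (\<mu>2' + r * \<mu>1') - (\<gamma> - r) * E)\<^sup>2"
    using p by simp_all
  have "(\<mu>1 - \<mu>1')\<^sup>2 = 0" using le Vle nn by linarith
  then show "\<mu>1 = \<mu>1'" by simp
  have "M 0 * (\<mu>2 + \<gamma> * \<mu>1 - (\<mu>2' + r * \<mu>1') - (\<gamma> - r) * E)\<^sup>2 = 0" using le Vle nn by linarith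
  then have "\<mu>2 + \<gamma> * \<mu>1 - (\<mu>2' + r * \<mu>1') = (\<gamma> - r) * E" using p by simp
  then show "M 0 * (\<mu>2 + \<gamma> * \<mu>1 - (\<mu>2' + r * \<mu>1')) = (\<gamma> - r) * M 1"
    by (simp add: E[unfolded One_nat_def])
  have "(\<gamma>n - r)\<^sup>2 * V = (\<gamma> - r)\<^sup>2 * V" using le Vle nn by linarith
  then have "\<bar>\<gamma>n - r\<bar> = \<bar>\<gamma> - r\<bar>" using V by (simp add: power2_eq_iff abs_eq_iff)
  then consider "\<gamma> = \<gamma>n" | "r = (\<gamma> + \<gamma>n) / 2" by (auto simp: abs_eq_iff field_simps)
  then show "\<gamma> = \<gamma>n"
  proof cases
    \<comment> \<open>two equidistant points of the interval enclose \<open>r\<close>, which is then itself the nearest point\<close>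
    case 2
    then have "r \<in> {\<gamma>l..\<gamma>h}" using g n(1) by (auto simp: field_simps)
    then have "\<gamma>n = r" using n(2)[of r] by simp
    then show ?thesis using 2 by simp
  qed
qed

subsection \<open>Comparison of the cutoffs\<close>

text \<open>Nonempty open intervals have positive measure; this extracts a point of contradiction
  from two almost-everywhere descriptions.\<close>

lemma AE_lborel_ex_between:
  fixes u v :: real
  assumes "AE x in lborel. P x" and "u < v"
  obtains x where "u < x" "x < v" "P x"
proof -
  have "\<exists>x. u < x \<and> x < v \<and> P x"
  proof (rule ccontr)
    assume *: "\<not> ?thesis"
    from assms(1) have "AE x in lborel. x \<notin> {u<..<v}"
      by eventually_elim (use * in auto)
    then have "emeasure lborel {u<..<v} = 0"
      by (subst (asm) AE_iff_measurable[where N = "{u<..<v}"]) auto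
    then show False using assms(2) by simp
  qed
  then show thesis using that by blast
qed

text \<open>The sign of a decides which side stops. For uniqueness, a second cutoff with the same
  stopping side disagrees between the two cutoffs, and one with the opposite side disagrees to the
  right of both.\<close>

lemma switching_cutoff_eq:
  fixes a k :: real
  assumes ae: "AE x in lborel. S x = Continue \<longleftrightarrow> a * x < k" and a: "a \<noteq> 0"
  shows "switching_cutoff S = k / a"
  unfolding switching_cutoff_def
proof (rule the_equality)
  define c where "c = k / a"
  have k: "k = a * c" using a by (simp add: c_def)
  have switch: "AE x in lborel. S x = Stop \<longleftrightarrow> (if a > 0 then x \<ge> c else x \<le> c)"
    using ae
  proof eventually_elim
    case (elim x)
    have "a * x < a * c \<longleftrightarrow> (if a > 0 then x < c else c < x)"
      using a by (auto simp: mult_less_cancel_left)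
    then show ?case using elim[unfolded k] by (cases "S x") (auto split: if_splits)
  qed
  then show "switches_at S (k / a)"
    unfolding switches_at_def c_def[symmetric] by (cases "a > 0") auto
  fix c' assume "switches_at S c'"
  then consider "AE x in lborel. S x = Stop \<longleftrightarrow> x \<ge> c'" | "AE x in lborel. S x = Stop \<longleftrightarrow> x \<le> c'"
    unfolding switches_at_def by blast
  then show "c' = k / a"
  proof cases
    case 1
    with switch have *: "AE x in lborel. x \<ge> c' \<longleftrightarrow> (if a > 0 then x \<ge> c else x \<le> c)"
      by eventually_elim auto
    show ?thesis
    proof (cases "a > 0")
      case True
      show ?thesis
      proof (rule ccontr)
        assume "c' \<noteq> k / a"
        then have "min c c' < max c c'" by (auto simp: c_def)
        from AE_lborel_ex_between[OF * this] obtain x where "min c c' < x" "x < max c c'"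
            "x \<ge> c' \<longleftrightarrow> (if a > 0 then x \<ge> c else x \<le> c)"
          by blast
        with True show False by (auto simp: min_def max_def split: if_splits)
      qed
    next
      case False
      have "max c c' < max c c' + 1" by simp
      from AE_lborel_ex_between[OF * this] obtain x where "max c c' < x"
          "x \<ge> c' \<longleftrightarrow> (if a > 0 then x \<ge> c else x \<le> c)"
        by blast
      with False show ?thesis by auto
    qed
  next
    case 2
    with switch have *: "AE x in lborel. x \<le> c' \<longleftrightarrow> (if a > 0 then x \<ge> c else x \<le> c)"
      by eventually_elim auto
    show ?thesis
    proof (cases "a > 0")
      case False
      show ?thesis
      proof (rule ccontr)
        assume "c' \<noteq> k / a"
        then have "min c c' < max c c'" by (auto simp: c_def)
        from AE_lborel_ex_between[OF * this] obtain x where "min c c' < x" "x < max c c'"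
            "x \<le> c' \<longleftrightarrow> (if a > 0 then x \<ge> c else x \<le> c)"
          by blast
        with False show False by (auto simp: min_def max_def split: if_splits)
      qed
    next
      case True
      have "max c c' < max c c' + 1" by simp
      from AE_lborel_ex_between[OF * this] obtain x where "max c c' < x"
          "x \<le> c' \<longleftrightarrow> (if a > 0 then x \<ge> c else x \<le> c)"
        by blast
      with True show ?thesis by auto
    qed
  qed
qed

theorem proposition3:
  fixes \<sigma> q \<kappa> \<mu>1_true \<mu>2_true r \<gamma>l \<gamma>h \<gamma>n \<mu>1_inf \<mu>2_inf \<gamma>_inf c_inf c_opt :: real
    and S_inf S_opt :: strategy
  assumes "\<sigma> > 0" and "0 \<le> q" and "q < 1"
    and "\<gamma>l \<le> \<gamma>h" and "r \<noteq> -1" and "\<gamma>l \<noteq> -1" and "\<gamma>h \<noteq> -1"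
    and "is_arg_min (\<lambda>g. \<bar>g - r\<bar>) (\<lambda>g. g \<in> {\<gamma>l..\<gamma>h}) \<gamma>n"
    and "\<bar>(r - \<gamma>n) / (1 + \<gamma>n)\<bar> < 1"
    and "(r > -1 \<and> \<gamma>n > -1) \<or> (r < -1 \<and> \<gamma>n < -1)"
    and "steady_state \<sigma> q \<kappa> \<mu>1_true \<mu>2_true r \<gamma>l \<gamma>h \<mu>1_inf \<mu>2_inf \<gamma>_inf S_inf"
    and "c_inf = switching_cutoff S_inf"
    and "optimal_strategy q \<kappa> (\<Psi> \<sigma> \<mu>1_true \<mu>2_true r) S_opt"
    and "c_opt = switching_cutoff S_opt"
  shows "(r - \<gamma>n < 0 \<longrightarrow> c_inf < c_opt) \<and> (r - \<gamma>n > 0 \<longrightarrow> c_inf > c_opt)"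
proof -
  note s = \<open>\<sigma> > 0\<close> \<open>0 \<le> q\<close> \<open>q < 1\<close>
  let ?A = "{x. S_inf x = Continue}"
  have cont: "continues_with_positive_probability S_inf"
    and opt: "optimal_strategy q \<kappa> (\<Psi> \<sigma> \<mu>1_inf \<mu>2_inf \<gamma>_inf) S_inf"
    and pt: "pseudo_true \<sigma> \<mu>1_true \<mu>2_true r \<gamma>l \<gamma>h S_inf (\<mu>1_inf, \<mu>2_inf, \<gamma>_inf)"
    using assms(11) by (auto simp: steady_state_def)
  have S: "is_strategy S_inf" using opt by (simp add: optimal_strategy_def)
  have A: "?A \<in> sets borel" "emeasure lborel ?A > 0"
    using strategy_sets[OF S] cont by (auto simp: continues_with_positive_probability_def)
  define M where "M = censored_moment \<mu>1_true \<sigma> ?A"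
  note par = pseudo_true_parameters[OF s(1) S cont assms(8) pt, folded M_def]
  have p: "M 0 > 0" by (rule par(4))
  define E where "E = M 1 / M 0"
  \<comment> \<open>The indifference value y depends only on \<sigma>, q and \<kappa>, so it is
    common to both models and cancels when \<open>k\<close> and \<open>k'\<close> are
    compared.\<close>
  obtain y where y: "excess \<sigma> q y = \<kappa>" using excess_attains[OF s] by blast
  define k where "k = \<mu>2_inf + \<gamma>n * \<mu>1_inf - y"
  define k' where "k' = \<mu>2_true + r * \<mu>1_true - y"
  have "\<mu>2_inf + \<gamma>n * \<mu>1_inf - (\<mu>2_true + r * \<mu>1_true) = (\<gamma>n - r) * E"
    using par(2,3) p by (simp add: E_def field_simps)
  then have kk': "k = k' + (\<gamma>n - r) * E" by (simp add: k_def k'_def)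
  have nz: "\<gamma>n \<noteq> -1" using assms(10) by auto
  have ae: "AE x in lborel. S_inf x = Continue \<longleftrightarrow> (1 + \<gamma>n) * x < k"
    using optimal_strategy_cutoff_rule[OF s opt y] nz by (simp add: par(2) k_def)
  have ae': "AE x in lborel. S_opt x = Continue \<longleftrightarrow> (1 + r) * x < k'"
    using optimal_strategy_cutoff_rule[OF s assms(13) y assms(5)] by (simp add: k'_def)
  have c: "(1 + \<gamma>n) * c_inf = k" using switching_cutoff_eq[OF ae] nz assms(12) by simp
  have c': "(1 + r) * c_opt = k'" using switching_cutoff_eq[OF ae'] assms(5,14) by simp
  \<comment> \<open>Integrates k - (1 + \<gamma>n) x, which is positive almost everywhere on the
    continuation region; dividing by \<open>M 0\<close> then places \<open>E\<close> strictly on the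
    continuing side of \<open>c_inf\<close>.\<close>
  have "k * M 0 + (- (1 + \<gamma>n)) * M 1 + 0 * M 2 > 0"
    using ae
    by (intro censored_integral_pos[OF s(1) A censored_quadratic[OF s(1) A(1),
          of \<mu>1_true k "- (1 + \<gamma>n)" 0, folded M_def]]) (auto elim!: eventually_mono simp: algebra_simps)
  then have "(1 + \<gamma>n) * (c_inf - E) > 0"
    using p by (simp add: c[symmetric] E_def field_simps)
  moreover have "(1 + r) * (c_inf - c_opt) = (r - \<gamma>n) * (c_inf - E)"
    using c c' kk' by (simp add: algebra_simps)
  ultimately have eq: "0 < (1 + \<gamma>n) * (c_inf - E)" "(1 + r) * (c_inf - c_opt) = (r - \<gamma>n) * (c_inf - E)"
    by auto
  \<comment> \<open>Since 1 + r and 1 + \<gamma>n have the same sign, so do 1 + r and c_inf - E;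
    these factors cancel in the signs of the identity.\<close>
  from assms(10) show ?thesis
  proof
    assume "r > -1 \<and> \<gamma>n > -1"
    then have pos: "1 + r > 0" "c_inf - E > 0" using eq(1) by (auto simp: zero_less_mult_iff)
    have "sgn (c_inf - c_opt) = sgn (r - \<gamma>n)"
      using arg_cong[OF eq(2), of sgn] pos by (simp add: sgn_mult)
    then show ?thesis by (auto simp: sgn_if split: if_splits)
  next
    assume "r < -1 \<and> \<gamma>n < -1"
    then have neg: "1 + r < 0" "c_inf - E < 0" using eq(1) by (auto simp: zero_less_mult_iff)
    have "sgn (c_inf - c_opt) = sgn (r - \<gamma>n)"
      using arg_cong[OF eq(2), of sgn] neg by (simp add: sgn_mult)
    then show ?thesis by (auto simp: sgn_if split: if_splits)
  qed
qed

end
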